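(* Let $X$ be a Banach space and let $Y$ be a closed subspace of $X$ such that $X/Y$ is finite dimensional and $Y$ has the Ball Huskable Property ($BHP$). Then $X$ has $BHP$.
   Context: The Banach spaces $X$ and $Y$ are real and nontrivial; $B_X$ is the closed unit ball of $X$. $X$ has $BHP$ if $B_X$ has nonempty relatively weakly open subsets of arbitrarily small diameter (for every $\varepsilon>0$ there is a nonempty relatively weakly open subset of $B_X$ of diameter less than $\varepsilon$). *)

theory Defs
  imports "HOL-Analysis.Analysis"
begin

text \<open>A subspace \<open>S\<close> of a normed space is regarded as a normed space in its own right, with the
  inherited norm; the whole space is the case \<open>S = UNIV\<close>. The values of a functional outside \<open>S\<close>
  are irrelevant.\<close>

definition bounded_functional_on :: "'a::real_normed_vector set \<Rightarrow> ('a \<Rightarrow> real) \<Rightarrow> bool" where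
  "bounded_functional_on S f \<longleftrightarrow>
     (\<forall>x\<in>S. \<forall>y\<in>S. f (x + y) = f x + f y) \<and>
     (\<forall>r. \<forall>x\<in>S. f (r *\<^sub>R x) = r * f x) \<and>
     (\<exists>K. \<forall>x\<in>S. \<bar>f x\<bar> \<le> K * norm x)"

lemma bounded_functional_on_UNIV: "bounded_functional_on UNIV f \<longleftrightarrow> bounded_linear f"
  unfolding bounded_functional_on_def bounded_linear_def bounded_linear_axioms_def linear_iff
  by (auto simp: mult.commute)

text \<open>The intrinsic weak topology of \<open>S\<close>: it is defined by the dual of \<open>S\<close> itself, not by the
  dual of the ambient space.\<close>

definition weak_topology_on :: "'a::real_normed_vector set \<Rightarrow> 'a topology" where
  "weak_topology_on S =
     topology_generated_by {{x \<in> S. f x \<in> U} |f U. bounded_functional_on S f \<and> open U}"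

lemma topspace_weak_topology_on [simp]: "topspace (weak_topology_on S) = S"
proof -
  have "bounded_functional_on S (\<lambda>_. 0)"
    by (auto simp: bounded_functional_on_def intro!: exI[of _ 0])
  then have "S \<in> {{x \<in> S. f x \<in> U} |f U. bounded_functional_on S f \<and> open U}"
    by (intro CollectI exI[of _ "\<lambda>_. 0"] exI[of _ UNIV]) auto
  then show ?thesis
    unfolding weak_topology_on_def topology_generated_by_topspace by blast
qed

definition BHP :: "'a::real_normed_vector set \<Rightarrow> bool" where
  "BHP S \<longleftrightarrow> (\<forall>\<epsilon>>0. \<exists>W. openin (subtopology (weak_topology_on S) (S \<inter> cball 0 1)) W \<and>
     W \<noteq> {} \<and> diameter W < \<epsilon>)"

text \<open>The quotient by \<open>Y\<close> consists of the cosets \<open>x +o Y\<close>. Addition of cosets is elementwise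
  addition of sets. Elementwise multiplication by \<open>0\<close> would give \<open>{0}\<close> instead of \<open>Y\<close>, which is
  why \<open>Y\<close> is added in the scalar multiplication.\<close>

definition quotient_space :: "'a::real_vector set \<Rightarrow> 'a set set" where
  "quotient_space Y = {x +o Y |x. True}"

definition quotient_scale :: "'a::real_vector set \<Rightarrow> real \<Rightarrow> 'a set \<Rightarrow> 'a set" where
  "quotient_scale Y r C = (\<lambda>x. r *\<^sub>R x) ` C + Y"

lemma quotient_plus:
  assumes "subspace Y"
  shows "(x +o Y) + (y +o Y) = (x + y) +o Y"
proof -
  have "\<exists>b\<in>Y. x + u + (y + v) = x + y + b" if "u \<in> Y" "v \<in> Y" for u v
    using that assms by (intro bexI[of _ "u + v"]) (auto simp: subspace_add)
  moreover have "\<exists>u\<in>Y. \<exists>v\<in>Y. x + y + b = (x + u) + (y + v)" if "b \<in> Y" for b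
    using that assms by (intro bexI[of _ b] bexI[of _ 0]) (auto simp: subspace_0)
  ultimately show ?thesis
    unfolding elt_set_plus_def set_plus_def by blast
qed

lemma quotient_scale:
  assumes "subspace Y"
  shows "quotient_scale Y r (x +o Y) = (r *\<^sub>R x) +o Y"
proof -
  have "\<exists>b\<in>Y. r *\<^sub>R (x + u) + v = r *\<^sub>R x + b" if "u \<in> Y" "v \<in> Y" for u v
    using that assms
    by (intro bexI[of _ "r *\<^sub>R u + v"]) (auto simp: subspace_add subspace_scale algebra_simps)
  moreover have "\<exists>u\<in>Y. \<exists>v\<in>Y. r *\<^sub>R x + b = r *\<^sub>R (x + u) + v" if "b \<in> Y" for b
    using that assms by (intro bexI[of _ 0] bexI[of _ b]) (auto simp: subspace_0)
  ultimately show ?thesis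
    unfolding quotient_scale_def elt_set_plus_def set_plus_def by blast
qed

text \<open>The quotient is spanned by finitely many of its elements. The summand \<open>Y\<close>, the zero of the
  quotient, only matters when \<open>B\<close> is empty, since the empty sum of sets is \<open>{0}\<close>.\<close>

definition finite_dim_quotient :: "'a::real_vector set \<Rightarrow> bool" where
  "finite_dim_quotient Y \<longleftrightarrow>
     (\<exists>B. finite B \<and> B \<subseteq> quotient_space Y \<and>
       (\<forall>C\<in>quotient_space Y. \<exists>c. C = Y + (\<Sum>A\<in>B. quotient_scale Y (c A) A)))"

end

theory Submission
  imports Defs
begin

text \<open>Adjoining one vector \<open>v\<close> to a closed subspace \<open>Y\<close> keeps it closed and keeps the ball huskable
  property; since \<open>Y\<close> has finite codimension, finitely many such steps reach the whole space.

  For one step let \<open>v \<notin> Y\<close> and \<open>Z = Y \<oplus> \<real>v\<close>. As \<open>Y\<close> is closed, \<open>v\<close> has positive distance from \<open>Y\<close>, so the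
  coefficient \<open>g x\<close> of \<open>v\<close> in \<open>x \<in> Z\<close> is a bounded functional of \<open>x\<close>. The map
  \<open>r x = (x - g x v) / (1 + \<bar>g x\<bar> \<parallel>v\<parallel>)\<close> sends the unit ball of \<open>Z\<close> to the unit ball of \<open>Y\<close>, is
  continuous for the two weak topologies, fixes the unit ball of \<open>Y\<close>, and moves a point \<open>x\<close> of the unit ball by at
  most \<open>2 \<bar>g x\<bar> \<parallel>v\<parallel>\<close>. Hence, if \<open>W\<close> is a nonempty relatively weakly open subset of the ball of
  \<open>Y\<close>, the points \<open>x\<close> of the ball of \<open>Z\<close> with \<open>r x \<in> W\<close> and \<open>\<bar>g x\<bar> < \<eta>\<close> form a relatively
  weakly open set that contains \<open>W\<close> and whose diameter is at most \<open>diameter W + 4 \<eta> \<parallel>v\<parallel>\<close>.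

  The denominator is there because the projection \<open>x \<mapsto> x - g x v\<close> alone may leave the unit ball,
  though its norm never exceeds \<open>1 + \<bar>g x\<bar> \<parallel>v\<parallel>\<close> there. The weak continuity of \<open>r\<close> comes from the
  same projection: composing a bounded functional on \<open>Y\<close> with it gives a bounded functional on
  \<open>Z\<close>.\<close>

section \<open>Continuity for the weak topology\<close>

lemma continuous_map_weak_functional:
  assumes "bounded_functional_on S f"
  shows "continuous_map (weak_topology_on S) euclideanreal f"
  unfolding continuous_map_def
proof (intro conjI allI impI)
  fix U :: "real set"
  assume "openin euclideanreal U"
  then have "{x \<in> S. f x \<in> U} \<in> {{x \<in> S. f x \<in> U} |f U. bounded_functional_on S f \<and> open U}"
    using assms by auto
  then have "openin (weak_topology_on S) {x \<in> S. f x \<in> U}"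
    unfolding weak_topology_on_def by (rule topology_generated_by_Basis)
  then show "openin (weak_topology_on S) {x \<in> topspace (weak_topology_on S). f x \<in> U}"
    by simp
qed auto

lemma continuous_map_into_weak_topology:
  assumes "\<And>x. x \<in> topspace T \<Longrightarrow> r x \<in> S"
    and "\<And>f. bounded_functional_on S f \<Longrightarrow> continuous_map T euclideanreal (\<lambda>x. f (r x))"
  shows "continuous_map T (weak_topology_on S) r"
  unfolding weak_topology_on_def
proof (rule continuous_on_generated_topo)
  fix A assume "A \<in> {{x \<in> S. f x \<in> U} |f U. bounded_functional_on S f \<and> open U}"
  then obtain f U where A: "A = {x \<in> S. f x \<in> U}" and f: "bounded_functional_on S f" and "open U"
    by blast
  then have "openin T {x \<in> topspace T. f (r x) \<in> U}"
    using openin_continuous_map_preimage[OF assms(2)[OF f]] by auto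
  moreover have "r -` A \<inter> topspace T = {x \<in> topspace T. f (r x) \<in> U}"
    using A assms(1) by auto
  ultimately show "openin T (r -` A \<inter> topspace T)" by simp
next
  have "topspace (weak_topology_on S) = S" by simp
  then show "r ` topspace T \<subseteq> \<Union> {{x \<in> S. f x \<in> U} |f U. bounded_functional_on S f \<and> open U}"
    unfolding weak_topology_on_def topology_generated_by_topspace using assms(1) by auto
qed

section \<open>Adjoining one vector\<close>

text \<open>The bound is \<open>\<bar>g x\<bar> \<le> \<parallel>x\<parallel> / dist(v, Y)\<close>: if \<open>x = y + k v\<close> with \<open>k \<noteq> 0\<close>, then \<open>x / k\<close> is the
  difference of \<open>v\<close> and the point \<open>- y / k\<close> of \<open>Y\<close>. Closedness of \<open>Y\<close> makes the distance positive.\<close>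

lemma bounded_coordinate_functional:
  fixes Y :: "'a::real_normed_vector set"
  assumes Y: "subspace Y" "closed Y" and v: "v \<notin> Y"
  obtains g where "bounded_functional_on (span (insert v Y)) g"
    and "\<And>x. x \<in> span (insert v Y) \<Longrightarrow> x - g x *\<^sub>R v \<in> Y"
    and "\<And>y. y \<in> Y \<Longrightarrow> g y = 0"
proof -
  define Z where "Z = span (insert v Y)"
  have Z_eq: "Z = {x. \<exists>k. x - k *\<^sub>R v \<in> Y}"
    unfolding Z_def span_insert using Y(1) by (simp add: span_eq_iff[THEN iffD2])
  have unique: "k = l" if "x - k *\<^sub>R v \<in> Y" "x - l *\<^sub>R v \<in> Y" for x k l
  proof (rule ccontr)
    assume "k \<noteq> l"
    have "(l - k) *\<^sub>R v \<in> Y"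
      using subspace_diff[OF Y(1) that] by (simp add: algebra_simps)
    then have "inverse (l - k) *\<^sub>R ((l - k) *\<^sub>R v) \<in> Y"
      by (rule subspace_scale[OF Y(1)])
    with \<open>k \<noteq> l\<close> v show False by simp
  qed
  define g where "g x = (THE k. x - k *\<^sub>R v \<in> Y)" for x
  have g_eqI: "g x = k" if "x - k *\<^sub>R v \<in> Y" for x k
    unfolding g_def using that unique by blast
  have g_mem: "x - g x *\<^sub>R v \<in> Y" if "x \<in> Z" for x
    using that g_eqI unfolding Z_eq by auto
  have "g (x + y) = g x + g y" if "x \<in> Z" "y \<in> Z" for x y
    using subspace_add[OF Y(1) g_mem[OF that(1)] g_mem[OF that(2)]]
    by (intro g_eqI) (simp add: algebra_simps)
  moreover have "g (a *\<^sub>R x) = a * g x" if "x \<in> Z" for a x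
    using subspace_scale[OF Y(1) g_mem[OF that], of a]
    by (intro g_eqI) (simp add: algebra_simps)
  moreover have "\<bar>g x\<bar> \<le> inverse (infdist v Y) * norm x" if "x \<in> Z" for x
  proof -
    have pos: "infdist v Y > 0"
      using Y v in_closed_iff_infdist_zero[of Y v] subspace_0[OF Y(1)] infdist_nonneg[of v Y]
      by (metis empty_iff less_eq_real_def)
    have "\<bar>g x\<bar> * infdist v Y \<le> norm x"
    proof (cases "g x = 0")
      case False
      have "(- inverse (g x)) *\<^sub>R (x - g x *\<^sub>R v) \<in> Y"
        by (rule subspace_scale[OF Y(1) g_mem[OF that]])
      then have "infdist v Y \<le> dist v ((- inverse (g x)) *\<^sub>R (x - g x *\<^sub>R v))"
        by (rule infdist_le)
      also have "\<dots> = norm x / \<bar>g x\<bar>"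
        using False by (simp add: dist_norm algebra_simps divide_inverse)
      finally show ?thesis using False by (simp add: field_simps)
    qed simp
    then show ?thesis using pos by (simp add: field_simps)
  qed
  ultimately have "bounded_functional_on Z g"
    unfolding bounded_functional_on_def by blast
  moreover have "g y = 0" if "y \<in> Y" for y
    using that by (intro g_eqI) simp
  ultimately show ?thesis using that g_mem unfolding Z_def by blast
qed

text \<open>Along a convergent sequence in the larger space the coordinates of \<open>v\<close> converge, because the
  coordinate functional is bounded; hence so do the components in \<open>Y\<close>, and their limit stays in
  \<open>Y\<close>.\<close>

lemma closed_span_insert:
  fixes Y :: "'a::real_normed_vector set"
  assumes Y: "subspace Y" "closed Y"
  shows "closed (span (insert v Y))"
proof (cases "v \<in> Y")
  case True
  then show ?thesis
    using Y by (simp add: insert_absorb span_eq_iff[THEN iffD2])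
next
  case False
  define Z where "Z = span (insert v Y)"
  obtain g where g: "bounded_functional_on Z g" and gY: "\<And>x. x \<in> Z \<Longrightarrow> x - g x *\<^sub>R v \<in> Y"
    using bounded_coordinate_functional[OF Y False] unfolding Z_def by metis
  have subZ: "subspace Z" unfolding Z_def by simp
  obtain K where K: "\<And>x. x \<in> Z \<Longrightarrow> \<bar>g x\<bar> \<le> K * norm x"
    using g unfolding bounded_functional_on_def by blast
  have g_diff: "g x - g y = g (x - y)" if "x \<in> Z" "y \<in> Z" for x y
  proof -
    have "g ((x - y) + y) = g (x - y) + g y"
      using g that subspace_diff[OF subZ] unfolding bounded_functional_on_def by blast
    then show ?thesis by simp
  qed
  have g_lip: "dist (g x) (g y) \<le> max K 1 * dist x y" if "x \<in> Z" "y \<in> Z" for x y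
    using K[OF subspace_diff[OF subZ that]] g_diff[OF that]
      mult_right_mono[of K "max K 1" "norm (x - y)"]
    by (simp add: dist_norm)
  have "l \<in> Z" if X: "\<And>n. X n \<in> Z" and lim: "X \<longlonglongrightarrow> l" for X l
  proof -
    have "Cauchy (\<lambda>n. g (X n))"
    proof (rule metric_CauchyI)
      fix e :: real assume "e > 0"
      then have "e / max K 1 > 0" by (simp add: max_def)
      then obtain M where M: "\<And>m n. m \<ge> M \<Longrightarrow> n \<ge> M \<Longrightarrow> dist (X m) (X n) < e / max K 1"
        using LIMSEQ_imp_Cauchy[OF lim] unfolding Cauchy_def by blast
      have "dist (g (X m)) (g (X n)) < e" if "m \<ge> M" "n \<ge> M" for m n
      proof -
        have "max K 1 * dist (X m) (X n) < e"
          using M[OF that] by (subst (asm) pos_less_divide_eq) (auto simp: max_def mult.commute)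
        then show ?thesis using g_lip[OF X X, of m n] by linarith
      qed
      then show "\<exists>M. \<forall>m\<ge>M. \<forall>n\<ge>M. dist (g (X m)) (g (X n)) < e" by blast
    qed
    then obtain t where "(\<lambda>n. g (X n)) \<longlonglongrightarrow> t"
      using Cauchy_convergent_iff convergent_def by blast
    then have "(\<lambda>n. X n - g (X n) *\<^sub>R v) \<longlonglongrightarrow> l - t *\<^sub>R v"
      by (intro tendsto_intros lim)
    then have "l - t *\<^sub>R v \<in> Y"
      using Y(2) gY[OF X] closed_sequentially[of Y "\<lambda>n. X n - g (X n) *\<^sub>R v"] by blast
    then show ?thesis
      unfolding Z_def span_insert by (blast intro: span_base)
  qed
  then show ?thesis
    unfolding Z_def closed_sequential_limits by blast
qed

lemma BHP_span_insert:
  fixes Y :: "'a::real_normed_vector set"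
  assumes Y: "subspace Y" "closed Y" and "BHP Y"
  shows "BHP (span (insert v Y))"
proof (cases "v \<in> Y")
  case True
  then show ?thesis
    using Y \<open>BHP Y\<close> by (simp add: insert_absorb span_eq_iff[THEN iffD2])
next
  case False
  define Z where "Z = span (insert v Y)"
  obtain g where g: "bounded_functional_on Z g" and gY: "\<And>x. x \<in> Z \<Longrightarrow> x - g x *\<^sub>R v \<in> Y"
    and g0: "\<And>y. y \<in> Y \<Longrightarrow> g y = 0"
    using bounded_coordinate_functional[OF Y False] unfolding Z_def by metis
  have subZ: "subspace Z" unfolding Z_def by simp
  have YZ: "Y \<subseteq> Z" unfolding Z_def by (auto intro: span_base)
  have "norm v > 0" using False subspace_0[OF Y(1)] by auto
  define s where "s x = \<bar>g x\<bar> * norm v" for x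
  have s_nonneg: "0 \<le> s x" for x by (simp add: s_def)
  define r where "r x = inverse (1 + s x) *\<^sub>R (x - g x *\<^sub>R v)" for x
  have r_mem: "r x \<in> Y \<inter> cball 0 1" if "x \<in> Z \<inter> cball 0 1" for x
  proof -
    have "norm (x - g x *\<^sub>R v) \<le> 1 + s x"
      using norm_triangle_ineq4[of x "g x *\<^sub>R v"] that by (simp add: s_def)
    then have "norm (r x) \<le> 1"
      using s_nonneg[of x] unfolding r_def norm_scaleR by (simp add: field_simps)
    moreover have "r x \<in> Y"
      unfolding r_def using that by (intro subspace_scale[OF Y(1)] gY) auto
    ultimately show ?thesis by simp
  qed
  have r_fix: "r y = y" if "y \<in> Y" for y
    using g0[OF that] by (simp add: r_def s_def)
  have r_near: "dist x (r x) \<le> 2 * s x" if "x \<in> Z \<inter> cball 0 1" for x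
  proof -
    \<comment> \<open>The projection \<open>(1 + s x) r x\<close> lies at distance \<open>s x\<close> from \<open>x\<close>, and at distance at most
      \<open>s x\<close> from \<open>r x\<close> because \<open>r x\<close> is in the unit ball.\<close>
    have "(1 + s x) *\<^sub>R r x = x - g x *\<^sub>R v"
      using s_nonneg[of x] by (simp add: r_def)
    then have "x - r x = g x *\<^sub>R v + s x *\<^sub>R r x"
      by (simp add: algebra_simps)
    then have "norm (x - r x) \<le> s x + s x * norm (r x)"
      using norm_triangle_ineq[of "g x *\<^sub>R v" "s x *\<^sub>R r x"] s_nonneg[of x] by (simp add: s_def)
    also have "\<dots> \<le> s x + s x * 1"
      using r_mem[OF that] s_nonneg[of x] by (intro add_left_mono mult_left_mono) auto
    finally show ?thesis by (simp add: dist_norm)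
  qed
  have g_cont: "continuous_map (weak_topology_on Z) euclideanreal g"
    by (rule continuous_map_weak_functional[OF g])
  have proj_functional: "bounded_functional_on Z (\<lambda>x. f (x - g x *\<^sub>R v))"
    if f: "bounded_functional_on Y f" for f
  proof -
    obtain K where K: "\<And>y. y \<in> Y \<Longrightarrow> \<bar>f y\<bar> \<le> K * norm y"
      using f unfolding bounded_functional_on_def by blast
    obtain L where L: "\<And>x. x \<in> Z \<Longrightarrow> \<bar>g x\<bar> \<le> L * norm x"
      using g unfolding bounded_functional_on_def by blast
    have "f (x + y - g (x + y) *\<^sub>R v) = f (x - g x *\<^sub>R v) + f (y - g y *\<^sub>R v)"
      if "x \<in> Z" "y \<in> Z" for x y
    proof -
      have "x + y - g (x + y) *\<^sub>R v = (x - g x *\<^sub>R v) + (y - g y *\<^sub>R v)"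
        using g that unfolding bounded_functional_on_def by (simp add: algebra_simps)
      then show ?thesis
        using f gY[OF that(1)] gY[OF that(2)] unfolding bounded_functional_on_def by metis
    qed
    moreover have "f (a *\<^sub>R x - g (a *\<^sub>R x) *\<^sub>R v) = a * f (x - g x *\<^sub>R v)" if "x \<in> Z" for a x
    proof -
      have "a *\<^sub>R x - g (a *\<^sub>R x) *\<^sub>R v = a *\<^sub>R (x - g x *\<^sub>R v)"
        using g that unfolding bounded_functional_on_def by (simp add: algebra_simps)
      then show ?thesis
        using f gY[OF that] unfolding bounded_functional_on_def by metis
    qed
    moreover have "\<bar>f (x - g x *\<^sub>R v)\<bar> \<le> (\<bar>K\<bar> * (1 + L * norm v)) * norm x" if "x \<in> Z" for x
    proof -
      have "norm (x - g x *\<^sub>R v) \<le> norm x + \<bar>g x\<bar> * norm v"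
        using norm_triangle_ineq4[of x "g x *\<^sub>R v"] by simp
      also have "\<dots> \<le> norm x + (L * norm x) * norm v"
        by (intro add_left_mono mult_right_mono L that) simp
      finally have "\<bar>K\<bar> * norm (x - g x *\<^sub>R v) \<le> \<bar>K\<bar> * (norm x + (L * norm x) * norm v)"
        by (intro mult_left_mono) auto
      moreover have "K * norm (x - g x *\<^sub>R v) \<le> \<bar>K\<bar> * norm (x - g x *\<^sub>R v)"
        by (intro mult_right_mono) auto
      ultimately show ?thesis
        using K[OF gY[OF that]] by (simp add: algebra_simps)
    qed
    ultimately show ?thesis
      unfolding bounded_functional_on_def by blast
  qed
  have r_cont: "continuous_map (weak_topology_on Z) (weak_topology_on Y) r"
  proof (rule continuous_map_into_weak_topology)
    fix x assume "x \<in> topspace (weak_topology_on Z)"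
    then show "r x \<in> Y"
      unfolding r_def by (intro subspace_scale[OF Y(1)] gY) auto
  next
    fix f assume f: "bounded_functional_on Y f"
    have "continuous_map (weak_topology_on Z) euclideanreal (\<lambda>x. 1 + s x)"
      unfolding s_def by (intro continuous_intros g_cont)
    moreover have "1 + s x \<noteq> 0" for x
      using s_nonneg[of x] by linarith
    ultimately have "continuous_map (weak_topology_on Z) euclideanreal
        (\<lambda>x. inverse (1 + s x) * f (x - g x *\<^sub>R v))"
      by (intro continuous_map_real_mult continuous_map_real_inverse
          continuous_map_weak_functional[OF proj_functional[OF f]])
    moreover have "f (r x) = inverse (1 + s x) * f (x - g x *\<^sub>R v)" if "x \<in> Z" for x
      using f gY[OF that] unfolding bounded_functional_on_def r_def by blast
    ultimately show "continuous_map (weak_topology_on Z) euclideanreal (\<lambda>x. f (r x))"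
      by (auto intro: continuous_map_eq)
  qed
  let ?TZ = "subtopology (weak_topology_on Z) (Z \<inter> cball 0 1)"
  let ?TY = "subtopology (weak_topology_on Y) (Y \<inter> cball 0 1)"
  have r_ball_cont: "continuous_map ?TZ ?TY r"
    using r_mem continuous_map_from_subtopology[OF r_cont]
    by (auto simp: continuous_map_in_subtopology)
  have "\<exists>V. openin ?TZ V \<and> V \<noteq> {} \<and> diameter V < \<epsilon>" if "\<epsilon> > 0" for \<epsilon>
  proof -
    obtain W where W: "openin ?TY W" "W \<noteq> {}" "diameter W < \<epsilon> / 2"
      using \<open>BHP Y\<close> \<open>\<epsilon> > 0\<close> unfolding BHP_def by (meson half_gt_zero)
    have WY: "W \<subseteq> Y \<inter> cball 0 1"
      using openin_subset[OF W(1)] by auto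
    have "bounded W"
      using WY bounded_cball bounded_subset by blast
    \<comment> \<open>With this \<open>\<eta>\<close> the map \<open>r\<close> moves each point of \<open>V\<close> by at most \<open>2 \<eta> \<parallel>v\<parallel> = \<epsilon> / 4\<close>.\<close>
    define \<eta> where "\<eta> = \<epsilon> / (8 * norm v)"
    have "\<eta> > 0" using \<open>\<epsilon> > 0\<close> \<open>norm v > 0\<close> by (simp add: \<eta>_def)
    define V where "V = {x \<in> Z \<inter> cball 0 1. r x \<in> W} \<inter> {x \<in> Z \<inter> cball 0 1. g x \<in> {-\<eta><..<\<eta>}}"
    have "openin ?TZ {x \<in> topspace ?TZ. r x \<in> W}"
      by (rule openin_continuous_map_preimage[OF r_ball_cont W(1)])
    moreover have "openin ?TZ {x \<in> topspace ?TZ. g x \<in> {-\<eta><..<\<eta>}}"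
      using openin_continuous_map_preimage[OF continuous_map_from_subtopology[OF g_cont]]
      by (metis open_openin open_greaterThanLessThan)
    ultimately have "openin ?TZ V"
      unfolding V_def by (intro openin_Int) (simp_all add: Int_absorb1)
    moreover have "V \<noteq> {}"
    proof -
      obtain y where "y \<in> W" using W(2) by blast
      then have "y \<in> V"
        using WY YZ r_fix g0 \<open>\<eta> > 0\<close> unfolding V_def by auto
      then show ?thesis by blast
    qed
    moreover have "diameter V < \<epsilon>"
    proof -
      have near: "dist x (r x) \<le> \<epsilon> / 4" if "x \<in> V" for x
      proof -
        have "\<bar>g x\<bar> \<le> \<eta>" using that by (auto simp: V_def)
        then have "s x \<le> \<eta> * norm v" unfolding s_def by (intro mult_right_mono) auto
        also have "\<dots> = \<epsilon> / 8" using \<open>norm v > 0\<close> by (simp add: \<eta>_def)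
        finally show ?thesis using r_near[of x] that by (auto simp: V_def)
      qed
      have "dist x y \<le> \<epsilon> / 2 + diameter W" if "x \<in> V" "y \<in> V" for x y
      proof -
        have "dist (r x) (r y) \<le> diameter W"
          using that by (intro diameter_bounded_bound \<open>bounded W\<close>) (auto simp: V_def)
        moreover have "dist x y \<le> dist x (r x) + dist (r x) (r y) + dist y (r y)"
          by (metis add.assoc add_left_mono dist_commute dist_triangle order_trans)
        ultimately show ?thesis using near[OF that(1)] near[OF that(2)] by linarith
      qed
      then have "diameter V \<le> \<epsilon> / 2 + diameter W"
        using \<open>V \<noteq> {}\<close> by (intro diameter_le) (auto simp: dist_norm)
      then show ?thesis using W(3) by linarith
    qed
    ultimately show ?thesis by blast
  qed
  then show ?thesis
    unfolding BHP_def Z_def by blast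
qed

section \<open>Finite codimension\<close>

lemma closed_BHP_span_Un_finite:
  fixes Y :: "'a::real_normed_vector set"
  assumes "finite T" and Y: "subspace Y" "closed Y" "BHP Y"
  shows "closed (span (T \<union> Y)) \<and> BHP (span (T \<union> Y))"
  using \<open>finite T\<close>
proof induction
  case empty
  then show ?case using Y by (simp add: span_eq_iff[THEN iffD2])
next
  case (insert v T)
  have "span (insert v T \<union> Y) = span (insert v (span (T \<union> Y)))"
    by (simp add: span_insert span_span)
  then show ?case
    using insert.IH by (simp add: closed_span_insert BHP_span_insert)
qed

text \<open>A representative of each of the spanning cosets, together with \<open>Y\<close>, spans the space.\<close>

lemma finite_dim_quotient_imp_span:
  fixes Y :: "'a::real_vector set"
  assumes Y: "subspace Y" and "finite_dim_quotient Y"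
  obtains T where "finite T" and "span (T \<union> Y) = UNIV"
proof -
  obtain B where "finite B" and B: "B \<subseteq> quotient_space Y"
    and gen: "\<And>C. C \<in> quotient_space Y \<Longrightarrow> \<exists>c. C = Y + (\<Sum>A\<in>B. quotient_scale Y (c A) A)"
    using assms(2) unfolding finite_dim_quotient_def by blast
  have "\<forall>A\<in>B. \<exists>a. A = a +o Y"
    using B unfolding quotient_space_def by blast
  then obtain a where a: "\<And>A. A \<in> B \<Longrightarrow> A = a A +o Y"
    by metis
  let ?S = "span (a ` B \<union> Y)"
  have YS: "y \<in> ?S" if "y \<in> Y" for y
    using that by (simp add: span_base)
  have scale: "quotient_scale Y k A \<subseteq> ?S" if "A \<in> B" for k A
  proof -
    have "quotient_scale Y k A = (k *\<^sub>R a A) +o Y"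
      using a[OF that] quotient_scale[OF Y] by metis
    moreover have "k *\<^sub>R a A \<in> ?S"
      using that by (intro span_scale span_base) auto
    ultimately show ?thesis
      by (auto simp: elt_set_plus_def intro: span_add YS)
  qed
  have "x \<in> ?S" for x
  proof -
    have "x +o Y \<in> quotient_space Y" unfolding quotient_space_def by blast
    then obtain c where c: "x +o Y = Y + (\<Sum>A\<in>B. quotient_scale Y (c A) A)"
      using gen by blast
    have "x \<in> x +o Y"
      using subspace_0[OF Y] unfolding elt_set_plus_def by force
    then obtain y z where x: "x = y + z" "y \<in> Y" and "z \<in> (\<Sum>A\<in>B. quotient_scale Y (c A) A)"
      unfolding c by (auto elim: set_plus_elim)
    then obtain h where "z = (\<Sum>A\<in>B. h A)" "\<forall>A\<in>B. h A \<in> quotient_scale Y (c A) A"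
      unfolding set_sum_alt[OF \<open>finite B\<close>] by blast
    then have "z \<in> ?S"
      using scale by (auto intro!: span_sum)
    then show ?thesis
      using x YS by (auto intro: span_add)
  qed
  then show ?thesis
    using that[of "a ` B"] \<open>finite B\<close> by blast
qed

theorem proposition4p3:
  fixes Y :: "'a::banach set"
  assumes "subspace Y" and "closed Y" and "Y \<noteq> {0}"
    and "finite_dim_quotient Y"
    and "BHP Y"
  shows "BHP (UNIV :: 'a set)"
proof -
  obtain T where "finite T" and "span (T \<union> Y) = UNIV"
    using finite_dim_quotient_imp_span assms by blast
  then show ?thesis
    using closed_BHP_span_Un_finite[of T Y] assms by simp
qed

end
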